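(* Let $N\ge 1$ and $1\le k\le N$ be integers, and write $N\%k\in\{0,1,\dots,k-1\}$ for the remainder of $N$ upon division by $k$. Then for every $j$ with $0\le j\le k-1$, $$\Gamma_{j,k,\lfloor N/k\rfloor}(N)=\frac{1}{k^{\lfloor N/k\rfloor+2}\,\lfloor N/k\rfloor!}\;\sigma_{k}\bigl(-j;\,k-1-(N\%k)\bigr).$$
   Context: For $r,s,a\in\mathbb{Q}[x]$ with $a$ non-constant and $\gcd(s,a)=1$, $\mathrm{eval}(r/s;a)$ denotes the remainder of $\alpha(x)r(x)$ upon division by $a(x)$, where $\alpha\in\mathbb{Q}[x]$ satisfies $\alpha s\equiv 1 \pmod a$ (equivalently, the unique polynomial of degree $<\deg a$ congruent to $r s^{-1}$ modulo $a$). Convention: $\Phi_1(x)=1-x$, and for $n\ge 2$, $\Phi_n(x)$ is the $n$-th cyclotomic polynomial, so $1-x^n=\prod_{d\mid n}\Phi_d(x)$ and $\prod_{i=1}^N(1-x^i)=\prod_{i=1}^N\Phi_i(x)^{\lfloor N/i\rfloor}$. Let $\Theta_k(x)=(1-x^k)/\Phi_k(x)$. Define $$h_k^{(N)}(x)=\mathrm{eval}\Bigl(\frac{1}{\prod_{1\le i\le N,\ i\ne k}\Phi_i(x)^{\lfloor N/i\rfloor}};\ \Phi_k(x)^{\lfloor N/k\rfloor}\Bigr),\qquad g_k^{(N)}(x)=\Theta_k(x)^{\lfloor N/k\rfloor}h_k^{(N)}(x),$$ and let $g_{k,\lfloor N/k\rfloor}^{(N)}(x)$ be the remainder of $g_k^{(N)}(x)$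 upon division by $1-x^k$; write $g_{k,\lfloor N/k\rfloor}^{(N)}(x)=\sum_{h=0}^{k-1}\Gamma_{h,k,\lfloor N/k\rfloor}(N)x^h$. Let $\Delta_k$ be the set of primitive $k$-th roots of unity, $(q)_n=\prod_{i=1}^n(1-q^i)$ for $n\ge1$ and $(q)_0=1$. For integers $k\ge1$, $0\le j<k$ and $t\in\mathbb{Z}$, the Gaussian–Ramanujan sum is $\sigma_k(t;j)=\sum_{\xi\in\Delta_k}\xi^{-t}(\xi)_j$. *)

theory Defs
  imports
    Complex_Main
    "HOL-Computational_Algebra.Computational_Algebra"
    "HOL-Number_Theory.Cong"
begin

definition prim_roots :: "nat \<Rightarrow> complex set" where
  "prim_roots n = {\<xi>. \<xi> ^ n = 1 \<and> (\<forall>m. 0 < m \<and> m < n \<longrightarrow> \<xi> ^ m \<noteq> 1)}"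

text \<open>The first cyclotomic polynomial is normalised as \<open>1 - x\<close> rather than \<open>x - 1\<close>.\<close>

definition cyclotomic_complex :: "nat \<Rightarrow> complex poly" where
  "cyclotomic_complex n = (if n = 1 then [:1, -1:] else (\<Prod>\<xi>\<in>prim_roots n. [:-\<xi>, 1:]))"

text \<open>The same polynomial over \<open>\<rat>\<close>; the description is justified by
  \<open>of_rat_cyclotomic\<close> below.\<close>

definition cyclotomic :: "nat \<Rightarrow> rat poly" where
  "cyclotomic n = (THE p. map_poly of_rat p = cyclotomic_complex n)"

text \<open>The remainder does not depend on the chosen inverse; see \<open>eval_frac_eq\<close> below.\<close>

definition eval_frac :: "rat poly \<Rightarrow> rat poly \<Rightarrow> rat poly \<Rightarrow> rat poly" where
  "eval_frac r s a = ((SOME \<alpha>. [\<alpha> * s = 1] (mod a)) * r) mod a"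

definition Theta :: "nat \<Rightarrow> rat poly" where
  "Theta k = (1 - monom 1 k) div cyclotomic k"

definition h_poly :: "nat \<Rightarrow> nat \<Rightarrow> rat poly" where
  "h_poly N k = eval_frac 1 (\<Prod>i\<in>{1..N} - {k}. cyclotomic i ^ (N div i)) (cyclotomic k ^ (N div k))"

definition g_poly :: "nat \<Rightarrow> nat \<Rightarrow> rat poly" where
  "g_poly N k = Theta k ^ (N div k) * h_poly N k"

definition g_rem :: "nat \<Rightarrow> nat \<Rightarrow> rat poly" where
  "g_rem N k = g_poly N k mod (1 - monom 1 k)"

text \<open>\<open>Gamma_coeff j k N\<close> is \<open>\<Gamma>\<close> with indices \<open>j\<close>, \<open>k\<close>, \<open>N div k\<close>, evaluated at \<open>N\<close>.\<close>

definition Gamma_coeff :: "nat \<Rightarrow> nat \<Rightarrow> nat \<Rightarrow> rat" where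
  "Gamma_coeff j k N = coeff (g_rem N k) j"

definition q_factorial :: "complex \<Rightarrow> nat \<Rightarrow> complex" where
  "q_factorial q n = (\<Prod>i=1..n. 1 - q ^ i)"

definition gauss_ramanujan_sum :: "nat \<Rightarrow> int \<Rightarrow> nat \<Rightarrow> complex" where
  "gauss_ramanujan_sum k t j = (\<Sum>\<xi>\<in>prim_roots k. \<xi> powi (- t) * q_factorial \<xi> j)"


lemma eval_frac_eq:
  assumes "[\<alpha> * s = 1] (mod a)"
  shows "eval_frac r s a = (\<alpha> * r) mod a"
proof -
  define \<beta> where "\<beta> = (SOME \<beta>. [\<beta> * s = 1] (mod a))"
  have b: "[\<beta> * s = 1] (mod a)"
    unfolding \<beta>_def by (rule someI[of _ \<alpha>]) (rule assms)
  have "[\<beta> * (\<alpha> * s) = \<beta> * 1] (mod a)" by (rule cong_mult) (simp_all add: assms)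
  moreover have "[\<alpha> * (\<beta> * s) = \<alpha> * 1] (mod a)" by (rule cong_mult) (simp_all add: b)
  ultimately have "[\<beta> = \<alpha>] (mod a)" by (simp add: cong_def mult.left_commute)
  hence "[\<beta> * r = \<alpha> * r] (mod a)" by (rule cong_mult) simp
  thus ?thesis by (simp add: eval_frac_def \<beta>_def cong_def)
qed

abbreviation (input) cpoly :: "rat poly \<Rightarrow> complex poly" where
  "cpoly \<equiv> map_poly of_rat"

lemma cpoly_add: "cpoly (p + q) = cpoly p + cpoly q"
  by (rule poly_eqI) (simp add: coeff_map_poly of_rat_add)

lemma cpoly_mult: "cpoly (p * q) = cpoly p * cpoly q"
  by (rule poly_eqI) (simp add: coeff_map_poly coeff_mult of_rat_sum of_rat_mult)

lemma cpoly_prod: "cpoly (prod f A) = (\<Prod>i\<in>A. cpoly (f i))"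
  by (induction A rule: infinite_finite_induct) (simp_all add: cpoly_mult map_poly_1)

lemma cpoly_inject: "cpoly p = cpoly q \<longleftrightarrow> p = q"
  by (auto simp: poly_eq_iff coeff_map_poly)

lemma cpoly_one_minus: "cpoly (1 - monom 1 n) = 1 - monom 1 n"
  by (rule poly_eqI) (auto simp: coeff_map_poly of_rat_diff)

lemma degree_cpoly: "degree (cpoly p) = degree p"
  by (rule degree_map_poly) auto

lemma prod_unity_roots:
  assumes "n > 0"
  shows "(\<Prod>z\<in>{z::complex. z ^ n = 1}. [:-z, 1:]) = monom 1 n - 1"
proof (rule poly_eqI_degree_lead_coeff[where n = n and A = "{z::complex. z ^ n = 1}"])
  let ?U = "{z::complex. z ^ n = 1}"
  have fin: "finite ?U" using assms by (intro finite_roots_unity) auto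
  have card: "card ?U = n" using assms by (rule card_roots_unity_eq)
  have deg: "degree (\<Prod>z\<in>?U. [:-z, 1:]) = n"
    by (subst degree_prod_eq_sum_degree) (auto simp: card)
  show "degree (\<Prod>z\<in>?U. [:-z, 1:]) \<le> n" using deg by simp
  show "degree (monom 1 n - 1 :: complex poly) \<le> n"
    by (intro degree_diff_le) (auto simp: degree_monom_eq)
  show "card ?U \<ge> n" using card by simp
  have "lead_coeff (\<Prod>z\<in>?U. [:-z, 1:]) = 1" by (simp add: lead_coeff_prod)
  thus "coeff (\<Prod>z\<in>?U. [:-z, 1:]) n = coeff (monom 1 n - 1) n"
    using deg assms by simp
  show "poly (\<Prod>z\<in>?U. [:-z, 1:]) z = poly (monom 1 n - 1) z" if "z \<in> ?U" for z
    using that fin by (auto simp: poly_prod poly_monom)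
qed

lemma unity_roots_eq_Union_prim_roots:
  assumes "n > 0"
  shows "{z::complex. z ^ n = 1} = (\<Union>d\<in>{d. d dvd n}. prim_roots d)"
proof (intro set_eqI iffI)
  fix z :: complex assume "z \<in> {z. z ^ n = 1}"
  hence z: "z ^ n = 1" by simp
  define d where "d = (LEAST m. 0 < m \<and> z ^ m = 1)"
  have d: "0 < d \<and> z ^ d = 1"
    unfolding d_def by (rule LeastI[of _ n]) (use z assms in auto)
  have min: "z ^ m \<noteq> 1" if "0 < m" "m < d" for m
    using not_less_Least[of m "\<lambda>m. 0 < m \<and> z ^ m = 1"] that by (auto simp: d_def)
  have "z ^ n = z ^ (d * (n div d) + n mod d)" by simp
  also have "\<dots> = (z ^ d) ^ (n div d) * z ^ (n mod d)" by (simp only: power_add power_mult)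
  finally have "z ^ (n mod d) = 1" using d z by simp
  hence "n mod d = 0" using min[of "n mod d"] d by auto
  thus "z \<in> (\<Union>d\<in>{d. d dvd n}. prim_roots d)"
    using d min by (auto simp: prim_roots_def mod_eq_0_iff_dvd)
next
  fix z assume "z \<in> (\<Union>d\<in>{d. d dvd n}. prim_roots d)"
  thus "z \<in> {z. z ^ n = 1}" by (auto simp: prim_roots_def power_mult elim: dvdE)
qed

lemma prim_roots_disjoint:
  assumes "0 < c" "0 < d" "c \<noteq> d"
  shows "prim_roots c \<inter> prim_roots d = {}"
  using assms by (auto simp: prim_roots_def) (metis linorder_neqE_nat)

lemma finite_prim_roots: "n > 0 \<Longrightarrow> finite (prim_roots n)"
  by (rule finite_subset[OF _ finite_roots_unity[of n]]) (auto simp: prim_roots_def)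

lemma prim_roots_1: "prim_roots (Suc 0) = {1}"
  by (auto simp: prim_roots_def)

lemma prod_cyclotomic_complex:
  assumes "n > 0"
  shows "(\<Prod>d | d dvd n. cyclotomic_complex d) = 1 - monom 1 n"
proof -
  let ?D = "{d. d dvd n}"
  have fin: "finite ?D" using assms by simp
  have pos: "d > 0" if "d \<in> ?D" for d using that assms by (auto intro: gr0I)
  have "(\<Prod>d\<in>?D. cyclotomic_complex d) =
      (\<Prod>d\<in>?D. (if d = 1 then -1 else 1) * (\<Prod>\<xi>\<in>prim_roots d. [:-\<xi>, 1:]))"
    by (rule prod.cong) (auto simp: cyclotomic_complex_def prim_roots_1)
  also have "\<dots> = - (\<Prod>d\<in>?D. \<Prod>\<xi>\<in>prim_roots d. [:-\<xi>, 1:])"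
    using fin by (simp add: prod.distrib prod.delta)
  also have "(\<Prod>d\<in>?D. \<Prod>\<xi>\<in>prim_roots d. [:-\<xi>, 1:]) =
      (\<Prod>\<xi>\<in>(\<Union>d\<in>?D. prim_roots d). [:-\<xi>, 1:])"
  proof (rule prod.UNION_disjoint[symmetric])
    show "\<forall>i\<in>?D. finite (prim_roots i)" using pos finite_prim_roots by blast
    show "\<forall>i\<in>?D. \<forall>j\<in>?D. i \<noteq> j \<longrightarrow> prim_roots i \<inter> prim_roots j = {}"
      using pos prim_roots_disjoint by blast
  qed (fact fin)
  also have "\<dots> = monom 1 n - 1"
    using prod_unity_roots[OF assms] unity_roots_eq_Union_prim_roots[OF assms] by simp
  finally show ?thesis by simp
qed

lemma ex_rat_cyclotomic:
  assumes "n > 0"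
  shows "\<exists>p. cpoly p = cyclotomic_complex n"
  using assms
proof (induction n rule: less_induct)
  case (less n)
  let ?D = "{d. d dvd n}"
  have fin: "finite ?D" using less.prems by simp
  have "\<forall>d\<in>?D - {n}. \<exists>p. cpoly p = cyclotomic_complex d"
  proof
    fix d assume d: "d \<in> ?D - {n}"
    hence "d \<le> n" using less.prems by (auto dest: dvd_imp_le)
    hence "d < n" using d by auto
    moreover have "d > 0" using d less.prems by (cases d) auto
    ultimately show "\<exists>p. cpoly p = cyclotomic_complex d" by (rule less.IH)
  qed
  then obtain f where f: "\<And>d. d \<in> ?D - {n} \<Longrightarrow> cpoly (f d) = cyclotomic_complex d"
    by metis
  define R where "R = prod f (?D - {n})"
  define C where "C = cyclotomic_complex n"
  have R: "cpoly R = (\<Prod>d\<in>?D - {n}. cyclotomic_complex d)"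
    unfolding R_def cpoly_prod using f by (intro prod.cong) auto
  have CR: "C * cpoly R = cpoly (1 - monom 1 n)"
    using prod_cyclotomic_complex[OF less.prems] prod.remove[OF fin, of n cyclotomic_complex]
    unfolding R C_def cpoly_one_minus by simp
  have "coeff (1 - monom 1 n :: rat poly) n \<noteq> 0" using less.prems by simp
  hence "1 - monom 1 n \<noteq> (0 :: rat poly)" by (metis coeff_0)
  hence R0: "R \<noteq> 0" using CR cpoly_inject[of "1 - monom 1 n" 0] by auto
  define Q where "Q = (1 - monom 1 n) div R"
  define S where "S = (1 - monom 1 n) mod R"
  have "1 - monom 1 n = Q * R + S" by (simp add: Q_def S_def)
  hence "C * cpoly R = cpoly Q * cpoly R + cpoly S"
    using CR by (simp add: cpoly_add cpoly_mult)
  hence eq: "(C - cpoly Q) * cpoly R = cpoly S" by (simp add: algebra_simps)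
  have "C - cpoly Q = 0"
  proof (rule ccontr)
    assume nz: "C - cpoly Q \<noteq> 0"
    have R0': "cpoly R \<noteq> 0" using R0 cpoly_inject[of R 0] by simp
    have S0: "S \<noteq> 0" using eq nz R0' by auto
    have "degree (cpoly S) = degree (C - cpoly Q) + degree (cpoly R)"
      using eq nz R0' by (metis degree_mult_eq)
    hence "degree S \<ge> degree R" by (simp add: degree_cpoly)
    moreover have "degree S < degree R"
      using S0 degree_mod_less[OF R0, of "1 - monom 1 n"] by (auto simp: S_def)
    ultimately show False by simp
  qed
  thus ?case by (auto simp: C_def)
qed

lemma of_rat_cyclotomic:
  assumes "n > 0"
  shows "map_poly of_rat (cyclotomic n) = cyclotomic_complex n"
  unfolding cyclotomic_def
proof (rule theI')
  obtain p where "map_poly of_rat p = cyclotomic_complex n"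
    using ex_rat_cyclotomic[OF assms] by blast
  thus "\<exists>!p. map_poly of_rat p = cyclotomic_complex n"
    by (intro ex1I[of _ p]) (simp_all flip: cpoly_inject)
qed

end

theory Submission
  imports Defs "HOL-Computational_Algebra.Field_as_Ring"
begin

text \<open>
  Write \<open>m = N div k\<close> and \<open>r = N mod k\<close>. As a polynomial of degree below \<open>k\<close>, \<open>g_rem N k\<close> is
  recovered from its values at the \<open>k\<close>-th roots of unity by the inverse discrete Fourier transform.
  These values are those of \<open>g_poly N k\<close>, which vanish at non-primitive roots because of the factor
  \<open>Theta k\<close>. Replacing each \<open>1 - x\<^sup>i\<close> with \<open>k dvd i\<close> by \<open>(1 - x\<^sup>i) / (1 - x\<^sup>k)\<close> in the product
  of the \<open>1 - x\<^sup>i\<close>, \<open>i \<le> N\<close>, leaves the cofactor of \<open>Theta k ^ m\<close> in the denominator of \<open>h_poly N k\<close>;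
  at a primitive root \<open>\<xi>\<close> that cofactor takes the value \<open>k ^ m * m! * (\<xi>)\<^sub>r\<close>.
  Finally \<open>(\<xi>)\<^sub>r * (1/\<xi>)\<^sub>s = k\<close> for \<open>r + s = k - 1\<close>.
\<close>

subsection \<open>Roots of unity\<close>

lemma prim_roots_inj_on_power:
  assumes "\<xi> \<in> prim_roots k"
  shows "inj_on (\<lambda>i. \<xi> ^ i) {..<k}"
proof (rule linorder_inj_onI)
  fix a b assume ab: "a < b" "a \<in> {..<k}" "b \<in> {..<k}"
  show "\<xi> ^ a \<noteq> \<xi> ^ b"
  proof
    assume eq: "\<xi> ^ a = \<xi> ^ b"
    have "\<xi> \<noteq> 0" using assms ab by (auto simp: prim_roots_def power_0_left)
    moreover have "\<xi> ^ b = \<xi> ^ a * \<xi> ^ (b - a)" using ab by (simp flip: power_add)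
    ultimately have "\<xi> ^ (b - a) = 1" using eq by simp
    moreover have "0 < b - a" "b - a < k" using ab by auto
    ultimately show False using assms by (auto simp: prim_roots_def)
  qed
qed auto

text \<open>The powers are distinct and there are exactly \<open>k\<close> of them, as many as there
  are roots of x^k = 1.\<close>

lemma prim_roots_bij_betw_power:
  assumes "\<xi> \<in> prim_roots k" "k > 0"
  shows "bij_betw (\<lambda>i. \<xi> ^ i) {..<k} {z. z ^ k = 1}"
proof -
  have "(\<lambda>i. \<xi> ^ i) ` {..<k} \<subseteq> {z. z ^ k = 1}"
    using assms by (auto simp: prim_roots_def power_commutes simp flip: power_mult)
      (metis mult.commute power_mult power_one)
  moreover have "card ((\<lambda>i. \<xi> ^ i) ` {..<k}) = card {z::complex. z ^ k = 1}"
    using prim_roots_inj_on_power[OF assms(1)] card_roots_unity_eq[OF assms(2)]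
    by (simp add: card_image)
  ultimately have "(\<lambda>i. \<xi> ^ i) ` {..<k} = {z. z ^ k = 1}"
    using assms by (intro card_subset_eq finite_roots_unity) auto
  thus ?thesis using prim_roots_inj_on_power[OF assms(1)] by (simp add: bij_betw_def)
qed

text \<open>Supplies a generator of the group of \<open>k\<close>-th roots of unity, so that sums
  over that group become sums over exponents.\<close>

lemma prim_roots_nonempty:
  assumes "k > 0"
  shows "prim_roots k \<noteq> {}"
proof -
  have bij: "bij_betw (\<lambda>i. cis (2 * pi * real i / real k)) {..<k} {z. z ^ k = 1}"
    using bij_betw_roots_unity[OF assms] .
  define w where "w = cis (2 * pi / real k)"
  have pw: "w ^ i = cis (2 * pi * real i / real k)" for i
    by (simp add: w_def DeMoivre mult_ac)
  have "w ^ i \<noteq> 1" if "0 < i" "i < k" for i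
  proof
    assume "w ^ i = 1"
    hence "cis (2 * pi * real i / real k) = cis (2 * pi * real 0 / real k)"
      by (simp flip: pw)
    moreover have "i \<in> {..<k}" "0 \<in> {..<k}" using that by auto
    ultimately have "i = 0" using bij unfolding bij_betw_def by (blast dest: inj_onD)
    thus False using that by simp
  qed
  moreover have "w ^ k = 1" using assms by (simp add: pw)
  ultimately have "w \<in> prim_roots k" by (auto simp: prim_roots_def)
  thus ?thesis by blast
qed

lemma inverse_in_prim_roots:
  "\<xi> \<in> prim_roots k \<Longrightarrow> inverse \<xi> \<in> prim_roots k"
  by (auto simp: prim_roots_def power_inverse)

text \<open>With a generator \<open>w\<close> this is a geometric sum of ratio \<open>w ^ n\<close>,
  which is 1 exactly when \<open>k\<close> divides \<open>n\<close>; otherwise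
  (\<open>w ^ n\<close>)^k = 1 makes it vanish.\<close>

lemma sum_roots_unity_power:
  assumes "k > 0"
  shows "(\<Sum>z | z ^ k = 1. z ^ n) = (if k dvd n then of_nat k else (0::complex))"
proof -
  obtain w where w: "w \<in> prim_roots k" using prim_roots_nonempty[OF assms] by blast
  have wk: "w ^ k = 1" using w by (simp add: prim_roots_def)
  have wn: "w ^ n = w ^ (n mod k)"
    by (metis div_mult_mod_eq mult.commute mult_1 power_add power_mult power_one wk)
  have "(\<Sum>z | z ^ k = 1. z ^ n) = (\<Sum>i<k. (w ^ i) ^ n)"
    using sum.reindex_bij_betw[OF prim_roots_bij_betw_power[OF w assms], of "\<lambda>z. z ^ n"]
    by simp
  also have "\<dots> = (\<Sum>i<k. (w ^ n) ^ i)" by (simp add: mult.commute flip: power_mult)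
  also have "\<dots> = (if k dvd n then of_nat k else 0)"
  proof (cases "k dvd n")
    case False
    hence "0 < n mod k" "n mod k < k" using assms by (auto simp: dvd_eq_mod_eq_0)
    hence "w ^ n \<noteq> 1" using w unfolding wn by (auto simp: prim_roots_def)
    moreover have "(w ^ n) ^ k = 1" by (metis mult.commute power_mult power_one wk)
    ultimately show ?thesis using False by (simp add: geometric_sum)
  qed (auto simp: wn)
  finally show ?thesis .
qed

text \<open>Inverse discrete Fourier transform: orthogonality isolates one coefficient, and the
  degree bound excludes other exponents congruent to \<open>j\<close> modulo
  \<open>k\<close>.\<close>

lemma coeff_eq_sum_roots_unity:
  fixes p :: "complex poly"
  assumes "degree p < k" "j < k"
  shows "of_nat k * coeff p j = (\<Sum>z | z ^ k = 1. poly p z * inverse z ^ j)"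
proof -
  have k: "k > 0" using assms by simp
  \<comment> \<open>Keeps all exponents natural numbers, as \<open>sum_roots_unity_power\<close>
    requires.\<close>
  have inv: "inverse z ^ j = z ^ (k - j)" if "z ^ k = 1" for z :: complex
  proof -
    have "z \<noteq> 0" using that k by (auto simp: power_0_left)
    moreover have "z ^ (k - j) * z ^ j = 1" using that assms by (simp flip: power_add)
    ultimately show ?thesis by (simp add: field_simps)
  qed
  \<comment> \<open>The exponent lies strictly between 0 and 2k, so the only multiple of
    \<open>k\<close> it can equal is \<open>k\<close> itself.\<close>
  have dvd: "k dvd i + (k - j) \<longleftrightarrow> i = j" if "i < k" for i
  proof
    assume "k dvd i + (k - j)"
    then obtain c where c: "i + (k - j) = k * c" by blast
    have "0 < k * c" "k * c < k * 2" using c that assms by linarith+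
    hence "c = 1" by simp
    thus "i = j" using c assms by simp
  qed (use assms in auto)
  have "(\<Sum>z | z ^ k = 1. poly p z * inverse z ^ j) =
      (\<Sum>z | z ^ k = 1. \<Sum>i<k. coeff p i * z ^ (i + (k - j)))"
  proof (rule sum.cong)
    fix z :: complex assume z: "z \<in> {z. z ^ k = 1}"
    have "poly p z = (\<Sum>i<k. coeff p i * z ^ i)"
      unfolding poly_altdef using assms
      by (intro sum.mono_neutral_left) (auto simp: coeff_eq_0)
    thus "poly p z * inverse z ^ j = (\<Sum>i<k. coeff p i * z ^ (i + (k - j)))"
      using inv z by (simp add: sum_distrib_right power_add mult.assoc)
  qed auto
  also have "\<dots> = (\<Sum>i<k. coeff p i * (\<Sum>z | z ^ k = 1. z ^ (i + (k - j))))"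
    by (subst sum.swap) (simp add: sum_distrib_left)
  also have "\<dots> = (\<Sum>i<k. if i = j then coeff p i * of_nat k else 0)"
    by (rule sum.cong) (auto simp: sum_roots_unity_power[OF k] dvd)
  also have "\<dots> = of_nat k * coeff p j" using assms by simp
  finally show ?thesis by simp
qed

subsection \<open>The products \<open>(\<xi>)\<^sub>n\<close> at a primitive root\<close>

lemma q_factorial_Suc: "q_factorial q (Suc n) = q_factorial q n * (1 - q ^ Suc n)"
  by (simp add: q_factorial_def)

text \<open>Factor x^k - 1 over the powers of \<xi>, cancel x - 1 to get 1 + x + ... + x^(k-1), and
  evaluate at 1.\<close>

lemma q_factorial_prim_root:
  assumes "\<xi> \<in> prim_roots k" "k > 0"
  shows "q_factorial \<xi> (k - 1) = of_nat k"
proof -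
  have "[:-1, 1:] * (\<Prod>i=1..k-1. [:-(\<xi> ^ i), 1:]) = (\<Prod>i<k. [:-(\<xi> ^ i), 1:])"
  proof -
    have "{..<k} = insert 0 {1..k-1}" using assms by auto
    thus ?thesis by simp
  qed
  also have "\<dots> = (\<Prod>z | z ^ k = 1. [:-z, 1:])"
    using prod.reindex_bij_betw[OF prim_roots_bij_betw_power[OF assms], of "\<lambda>z. [:-z, 1:]"]
    by simp
  also have "\<dots> = monom 1 k - 1" using prod_unity_roots[OF assms(2)] .
  also have "\<dots> = [:0, 1:] ^ k - 1" by (simp add: monom_altdef)
  also have "\<dots> = [:-1, 1:] * (\<Sum>i<k. [:0, 1:] ^ i)"
    by (subst power_diff_1_eq) (simp add: one_pCons)
  finally have "(\<Prod>i=1..k-1. [:-(\<xi> ^ i), 1:]) = (\<Sum>i<k. [:0, 1:] ^ i)"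
    by (subst (asm) mult_left_cancel) simp_all
  hence "poly (\<Prod>i=1..k-1. [:-(\<xi> ^ i), 1:]) 1 = poly (\<Sum>i<k. [:0, 1:] ^ i) 1" by simp
  thus ?thesis by (simp add: poly_prod poly_sum q_factorial_def)
qed

text \<open>Since \<xi>^(-i) = \<xi>^(k-i), the second factor supplies exactly the terms with
  indices r+1 to k-1 missing from the first.\<close>

lemma q_factorial_reflect:
  assumes "\<xi> \<in> prim_roots k" "k > 0" "r < k"
  shows "q_factorial \<xi> r * q_factorial (inverse \<xi>) (k - 1 - r) = of_nat k"
proof -
  have xi: "\<xi> ^ k = 1" "\<xi> \<noteq> 0" using assms by (auto simp: prim_roots_def power_0_left)
  have "q_factorial (inverse \<xi>) (k - 1 - r) = (\<Prod>i=r+1..k-1. 1 - \<xi> ^ i)"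
    unfolding q_factorial_def
  proof (rule prod.reindex_bij_witness[of _ "\<lambda>i. k - i" "\<lambda>i. k - i"])
    fix i assume i: "i \<in> {1..k - 1 - r}"
    hence "k - i + i = k" by auto
    hence "\<xi> ^ (k - i) * \<xi> ^ i = 1" using xi by (metis power_add)
    thus "1 - \<xi> ^ (k - i) = 1 - inverse \<xi> ^ i" using xi by (simp add: field_simps)
  qed auto
  moreover have "(\<Prod>i=1..r. 1 - \<xi> ^ i) * (\<Prod>i=r+1..k-1. 1 - \<xi> ^ i) = (\<Prod>i=1..k-1. 1 - \<xi> ^ i)"
    using prod.ub_add_nat[of 1 r "\<lambda>i. 1 - \<xi> ^ i" "k - 1 - r"] assms by simp
  ultimately show ?thesis using q_factorial_prim_root[OF assms(1,2)]
    by (simp add: q_factorial_def)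
qed

subsection \<open>Products of \<open>1 - x\<^sup>i\<close>\<close>

lemma Suc_div_eq: "Suc n div d = n div d + (if d dvd Suc n then 1 else 0)"
  by (simp add: div_Suc dvd_eq_mod_eq_0)

text \<open>Exchange of the order of multiplication: \<open>f d\<close> occurs once for each
  multiple of \<open>d\<close> among 1, ..., N.\<close>

lemma prod_prod_divisors:
  fixes f :: "nat \<Rightarrow> 'a :: comm_monoid_mult"
  shows "(\<Prod>n=1..N. \<Prod>d | d dvd n. f d) = (\<Prod>d=1..N. f d ^ (N div d))"
proof (induction N)
  case (Suc N)
  have "(\<Prod>d=1..Suc N. f d ^ (Suc N div d)) =
      (\<Prod>d=1..Suc N. f d ^ (N div d)) * (\<Prod>d=1..Suc N. if d dvd Suc N then f d else 1)"
    unfolding prod.distrib[symmetric] by (rule prod.cong) (auto simp: Suc_div_eq power_add)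
  \<comment> \<open>The extra factor at \<open>d = Suc N\<close> has exponent
    \<open>N div Suc N = 0\<close>.\<close>
  also have "(\<Prod>d=1..Suc N. f d ^ (N div d)) = (\<Prod>d=1..N. f d ^ (N div d))" by simp
  also have "(\<Prod>d=1..Suc N. if d dvd Suc N then f d else 1) = (\<Prod>d | d dvd Suc N. f d)"
  proof (rule prod.mono_neutral_cong_right)
    show "{d. d dvd Suc N} \<subseteq> {1..Suc N}"
      using dvd_imp_le[of _ "Suc N"] by (auto simp: Suc_le_eq dest: dvd_pos_nat[rotated])
  qed auto
  finally show ?case using Suc.IH by simp
qed simp

lemma prod_one_minus_monom:
  "(\<Prod>n=1..N. 1 - monom 1 n :: complex poly) = (\<Prod>d=1..N. cyclotomic_complex d ^ (N div d))"
  unfolding prod_prod_divisors[symmetric]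
  by (rule prod.cong) (auto simp: prod_cyclotomic_complex)

text \<open>For \<open>k dvd i\<close> with \<open>k > 0\<close> the geometric sum is the quotient
  (1 - x^i)/(1 - x^k) as a polynomial, so it can be evaluated at roots of unity where numerator and
  denominator both vanish.\<close>

definition reduced_factor :: "nat \<Rightarrow> nat \<Rightarrow> complex poly" where
  "reduced_factor k i = (if k dvd i then \<Sum>a<i div k. monom 1 k ^ a else 1 - monom 1 i)"

lemma prod_one_minus_monom_reduced:
  "(\<Prod>n=1..N. 1 - monom 1 n) = (1 - monom 1 k) ^ (N div k) * (\<Prod>i=1..N. reduced_factor k i)"
proof (induction N)
  case (Suc N)
  have "1 - monom 1 (Suc N) =
      (1 - monom 1 k) ^ (if k dvd Suc N then 1 else 0) * reduced_factor k (Suc N)"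
  proof (cases "k dvd Suc N")
    case True
    then obtain c where c: "Suc N = k * c" by blast
    hence "c > 0" "k > 0" by (auto intro: gr0I)
    have "1 - monom 1 (k * c) = 1 - monom 1 k ^ c" by (simp add: monom_power mult.commute)
    also have "\<dots> = (1 - monom 1 k) * (\<Sum>a<c. monom (1::complex) k ^ a)"
      by (rule one_diff_power_eq)
    finally show ?thesis using True \<open>k > 0\<close> by (simp add: reduced_factor_def c)
  qed (simp add: reduced_factor_def)
  thus ?case by (simp only: prod.cl_ivl_Suc Suc.IH Suc_div_eq power_add mult_ac)
      simp
qed simp

lemma poly_reduced_factor:
  assumes "\<xi> ^ k = 1"
  shows "poly (reduced_factor k i) \<xi> = (if k dvd i then of_nat (i div k) else 1 - \<xi> ^ i)"
  using assms by (simp add: reduced_factor_def poly_sum poly_monom)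

text \<open>In the b-th block of \<open>k\<close> consecutive indices, the non-multiples of
  \<open>k\<close> contribute \<open>q_factorial \<xi> (k - 1)\<close>, which is \<open>k\<close>,
  and the multiple contributes b. The incomplete last block leaves
  \<open>q_factorial \<xi> r\<close>.\<close>

lemma prod_poly_reduced_factor:
  assumes "\<xi> \<in> prim_roots k" "r < k"
  shows "(\<Prod>i=1..m * k + r. poly (reduced_factor k i) \<xi>) =
    of_nat k ^ m * fact m * q_factorial \<xi> r"
  using assms(2)
proof (induction m arbitrary: r)
  case 0
  show ?case unfolding q_factorial_def
    using 0 assms
    by (auto simp: poly_reduced_factor prim_roots_def intro!: prod.cong dest!: dvd_imp_le)
next
  case (Suc m)
  have k: "k > 0" and xi: "\<xi> ^ k = 1" using assms by (auto simp: prim_roots_def)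
  show ?case using Suc.prems
  proof (induction r)
    case 0
    \<comment> \<open>Splitting off the last index lets the outer induction hypothesis apply at
      remainder \<open>k - 1\<close>.\<close>
    have eq: "Suc m * k = Suc (m * k + (k - 1))" using k by simp
    have "(\<Prod>i=1..Suc m * k. poly (reduced_factor k i) \<xi>) =
        (\<Prod>i=1..m * k + (k - 1). poly (reduced_factor k i) \<xi>) * poly (reduced_factor k (Suc m * k)) \<xi>"
      unfolding eq by simp
    also have "\<dots> = of_nat k ^ m * fact m * of_nat k * of_nat (Suc m)"
      using Suc.IH[of "k - 1"] k xi q_factorial_prim_root[OF assms(1) k]
      by (simp add: poly_reduced_factor)
    finally show ?case by (simp add: q_factorial_def algebra_simps)
  next
    case (Suc r)
    have nd: "\<not> k dvd Suc m * k + Suc r"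
      using Suc.prems by (subst dvd_add_right_iff) (auto dest: dvd_imp_le)
    have "\<xi> ^ (Suc m * k + Suc r) = (\<xi> ^ k) ^ Suc m * \<xi> ^ Suc r"
      by (simp add: power_add mult.commute flip: power_mult)
    hence "poly (reduced_factor k (Suc m * k + Suc r)) \<xi> = 1 - \<xi> ^ Suc r"
      using nd xi by (simp add: poly_reduced_factor)
    moreover have "(\<Prod>i=1..Suc m * k + Suc r. poly (reduced_factor k i) \<xi>) =
        (\<Prod>i=1..Suc m * k + r. poly (reduced_factor k i) \<xi>) *
          poly (reduced_factor k (Suc m * k + Suc r)) \<xi>"
      by simp
    ultimately show ?case using Suc by (simp add: q_factorial_Suc)
  qed
qed

subsection \<open>Cyclotomic polynomials\<close>

lemma cpoly_1: "cpoly 1 = 1"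
  by (simp only: map_poly_1 of_rat_1 one_pCons[symmetric])

lemma cpoly_power: "cpoly (p ^ n) = cpoly p ^ n"
  by (induction n) (simp_all add: cpoly_mult map_poly_1)

lemma poly_cyclotomic_complex_eq_0_iff:
  assumes "n > 0"
  shows "poly (cyclotomic_complex n) z = 0 \<longleftrightarrow> z \<in> prim_roots n"
  using assms finite_prim_roots[OF assms]
  by (auto simp: cyclotomic_complex_def poly_prod prim_roots_1)

lemma cyclotomic_nonzero:
  assumes "n > 0"
  shows "cyclotomic n \<noteq> 0"
proof
  assume "cyclotomic n = 0"
  hence "cyclotomic_complex n = 0" using of_rat_cyclotomic[OF assms] by simp
  thus False using finite_prim_roots[OF assms] by (auto simp: cyclotomic_complex_def split: if_splits)
qed

text \<open>A non-constant common divisor would have a complex root, which would be primitive of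
  both orders.\<close>

lemma coprime_cyclotomic:
  assumes "m > 0" "n > 0" "m \<noteq> n"
  shows "coprime (cyclotomic m) (cyclotomic n)"
proof (rule coprimeI)
  fix d assume d: "d dvd cyclotomic m" "d dvd cyclotomic n"
  have d0: "d \<noteq> 0" using d cyclotomic_nonzero[OF assms(1)] by auto
  have root: "poly (cyclotomic_complex i) z = 0"
    if dvd: "d dvd cyclotomic i" and "i > 0" "poly (cpoly d) z = 0" for i z
  proof -
    obtain e where "cyclotomic i = d * e" using dvd by (rule dvdE)
    thus ?thesis using that by (simp add: cpoly_mult flip: of_rat_cyclotomic)
  qed
  have "degree d = 0"
  proof (rule ccontr)
    assume "degree d \<noteq> 0"
    hence "\<not> constant (poly (cpoly d))" by (simp add: constant_degree degree_cpoly)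
    then obtain z where z: "poly (cpoly d) z = 0"
      using fundamental_theorem_of_algebra by blast
    have "z \<in> prim_roots m" "z \<in> prim_roots n"
      using root[OF d(1) assms(1) z] root[OF d(2) assms(2) z]
      by (simp_all only: poly_cyclotomic_complex_eq_0_iff[OF assms(1)]
          poly_cyclotomic_complex_eq_0_iff[OF assms(2)])
    thus False using prim_roots_disjoint[OF assms] by blast
  qed
  thus "is_unit d" using d0 by (simp add: is_unit_iff_degree)
qed

text \<open>The division defining \<open>Theta\<close> is exact: the cofactor is the product over
  the proper divisors of \<open>k\<close>, and the complex identity descends to rational polynomials
  because \<open>cpoly\<close> is injective.\<close>

lemma Theta_mult_cyclotomic:
  assumes "k > 0"
  shows "Theta k * cyclotomic k = 1 - monom 1 k"
proof -
  define R where "R = (\<Prod>d\<in>{d. d dvd k} - {k}. cyclotomic d)"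
  have fin: "finite {d. d dvd k}" using assms by simp
  have "cpoly (cyclotomic k * R) = cpoly (\<Prod>d | d dvd k. cyclotomic d)"
    unfolding R_def using prod.remove[OF fin, of k cyclotomic] by simp
  also have "\<dots> = (\<Prod>d | d dvd k. cyclotomic_complex d)"
    unfolding cpoly_prod using assms
    by (intro prod.cong of_rat_cyclotomic refl) (auto intro: gr0I)
  also have "\<dots> = cpoly (1 - monom 1 k)"
    using prod_cyclotomic_complex[OF assms] by (simp only: cpoly_one_minus)
  finally have "cyclotomic k * R = 1 - monom 1 k" by (simp only: cpoly_inject)
  hence "cyclotomic k dvd 1 - monom 1 k" by (metis dvd_triv_left)
  thus ?thesis by (simp add: Theta_def)
qed

lemma poly_cpoly_Theta_eq_0:
  assumes "k > 0" "z ^ k = 1" "z \<notin> prim_roots k"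
  shows "poly (cpoly (Theta k)) z = 0"
proof -
  have "cpoly (Theta k) * cyclotomic_complex k = 1 - monom 1 k"
    using assms(1) by (simp add: Theta_mult_cyclotomic cpoly_one_minus
        flip: of_rat_cyclotomic cpoly_mult)
  hence "poly (cpoly (Theta k)) z * poly (cyclotomic_complex k) z = poly (1 - monom 1 k) z"
    by (metis poly_mult)
  thus ?thesis using assms by (simp add: poly_monom poly_cyclotomic_complex_eq_0_iff)
qed

subsection \<open>Values of \<open>g_poly\<close> at roots of unity\<close>

text \<open>Both sides times \<open>?C\<close> give the product of all 1 - x^n with n up to N, by
  its two factorisations; then \<open>?C\<close> is cancelled.\<close>

lemma cofactor_eq_Theta_power_mult:
  assumes "1 \<le> k" "k \<le> N"
  shows "(\<Prod>i\<in>{1..N} - {k}. cyclotomic_complex i ^ (N div i)) =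
    cpoly (Theta k) ^ (N div k) * (\<Prod>i=1..N. reduced_factor k i)" (is "?P = ?T * ?Q")
proof -
  let ?C = "cyclotomic_complex k ^ (N div k)"
  have k: "k > 0" using assms by simp
  have "?C * ?P = (\<Prod>n=1..N. 1 - monom 1 n)"
    using prod.remove[of "{1..N}" k "\<lambda>i. cyclotomic_complex i ^ (N div i)"] assms
    unfolding prod_one_minus_monom by simp
  also have "\<dots> = cpoly (Theta k * cyclotomic k) ^ (N div k) * ?Q"
    unfolding Theta_mult_cyclotomic[OF k] cpoly_one_minus by (rule prod_one_minus_monom_reduced)
  also have "\<dots> = ?C * (?T * ?Q)"
    by (simp add: cpoly_mult of_rat_cyclotomic[OF k] power_mult_distrib mult_ac)
  finally have "?C * ?P = ?C * (?T * ?Q)" .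
  moreover have "?C \<noteq> 0"
    using finite_prim_roots[OF k] by (auto simp: cyclotomic_complex_def)
  ultimately show ?thesis by (metis mult_left_cancel)
qed

lemma h_poly_cong:
  assumes "1 \<le> k" "k \<le> N"
  shows "[h_poly N k * (\<Prod>i\<in>{1..N} - {k}. cyclotomic i ^ (N div i)) = 1]
    (mod cyclotomic k ^ (N div k))" (is "[_ * ?P = 1] (mod ?M)")
proof -
  have "coprime ?P ?M"
    by (rule prod_coprime_left) (use assms in \<open>auto intro!: coprime_cyclotomic\<close>)
  \<comment> \<open>Bezout exhibits an inverse modulo \<open>?M\<close>, so
    \<open>eval_frac_eq\<close> replaces the arbitrarily chosen one.\<close>
  hence "fst (bezout_coefficients ?P ?M) * ?P + snd (bezout_coefficients ?P ?M) * ?M = 1"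
    by (simp add: bezout_coefficients_fst_snd)
  then obtain \<alpha> \<beta> where "\<alpha> * ?P + \<beta> * ?M = 1" by blast
  hence \<alpha>: "[\<alpha> * ?P = 1] (mod ?M)"
    by (metis cong_def mod_mult_self1)
  hence "h_poly N k = \<alpha> mod ?M" by (simp add: h_poly_def eval_frac_eq)
  thus ?thesis using \<alpha> by (simp add: cong_def mod_mult_left_eq)
qed

text \<open>The modulus vanishes at \<xi> because its exponent \<open>N div k\<close> is positive,
  so the congruence becomes an equality of values.\<close>

lemma poly_h_poly:
  assumes "1 \<le> k" "k \<le> N" "\<xi> \<in> prim_roots k"
  shows "poly (cpoly (h_poly N k)) \<xi> *
    poly (\<Prod>i\<in>{1..N} - {k}. cyclotomic_complex i ^ (N div i)) \<xi> = 1"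
proof -
  let ?P = "\<Prod>i\<in>{1..N} - {k}. cyclotomic i ^ (N div i)"
  have k: "k > 0" using assms by simp
  have "cyclotomic k ^ (N div k) dvd h_poly N k * ?P - 1"
    using h_poly_cong[OF assms(1,2)] by (simp add: cong_iff_dvd_diff)
  then obtain e where "h_poly N k * ?P - 1 = cyclotomic k ^ (N div k) * e" by blast
  hence "h_poly N k * ?P = 1 + cyclotomic k ^ (N div k) * e" by (simp add: algebra_simps)
  hence "cpoly (h_poly N k * ?P) = cpoly (1 + cyclotomic k ^ (N div k) * e)" by simp
  hence "cpoly (h_poly N k) * cpoly ?P = 1 + cyclotomic_complex k ^ (N div k) * cpoly e"
    by (simp only: cpoly_add cpoly_mult cpoly_power cpoly_1 of_rat_cyclotomic[OF k])
  hence "poly (cpoly (h_poly N k) * cpoly ?P) \<xi> =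
      poly (1 + cyclotomic_complex k ^ (N div k) * cpoly e) \<xi>" by simp
  hence "poly (cpoly (h_poly N k)) \<xi> * poly (cpoly ?P) \<xi> =
      1 + poly (cyclotomic_complex k) \<xi> ^ (N div k) * poly (cpoly e) \<xi>"
    by (simp only: poly_mult poly_add poly_1 poly_power)
  moreover have "cpoly ?P = (\<Prod>i\<in>{1..N} - {k}. cyclotomic_complex i ^ (N div i))"
    unfolding cpoly_prod cpoly_power by (intro prod.cong) (auto simp: of_rat_cyclotomic)
  moreover have "poly (cyclotomic_complex k) \<xi> ^ (N div k) = 0"
    using assms k by (simp add: poly_cyclotomic_complex_eq_0_iff div_greater_zero_iff)
  ultimately show ?thesis by (simp only: mult_zero_left add_0_right)
qed

lemma poly_g_poly_prim_root:
  assumes "1 \<le> k" "k \<le> N" "\<xi> \<in> prim_roots k"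
  shows "poly (cpoly (g_poly N k)) \<xi> =
    q_factorial (inverse \<xi>) (k - 1 - N mod k) / (of_nat k ^ (N div k + 1) * fact (N div k))"
proof -
  let ?g = "poly (cpoly (g_poly N k)) \<xi>"
  let ?m = "N div k" and ?r = "N mod k"
  let ?q = "q_factorial (inverse \<xi>) (k - 1 - ?r)"
  have k: "k > 0" using assms by simp
  have "?g * (\<Prod>i=1..N. poly (reduced_factor k i) \<xi>) = 1"
    using poly_h_poly[OF assms] unfolding cofactor_eq_Theta_power_mult[OF assms(1,2)]
    by (simp add: g_poly_def cpoly_mult cpoly_power poly_prod mult_ac)
  moreover have "(\<Prod>i=1..N. poly (reduced_factor k i) \<xi>) =
      of_nat k ^ ?m * fact ?m * q_factorial \<xi> ?r"
    using prod_poly_reduced_factor[OF assms(3), of ?r ?m] k by simp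
  ultimately have g: "?g * (of_nat k ^ ?m * fact ?m * q_factorial \<xi> ?r) = 1" by simp
  \<comment> \<open>The extra factor \<open>k\<close> is rewritten by reflection, which trades the
    reciprocal of \<open>q_factorial \<xi> ?r\<close> for \<open>?q\<close>.\<close>
  have "?g * (of_nat k ^ (?m + 1) * fact ?m) =
      ?g * (of_nat k ^ ?m * fact ?m) * (q_factorial \<xi> ?r * ?q)"
    using q_factorial_reflect[OF assms(3) k, of ?r] k by (simp add: mult_ac)
  also have "\<dots> = ?q" using g by (simp add: mult_ac)
  finally show ?thesis using k by (simp add: eq_divide_eq)
qed

text \<open>Reduction modulo 1 - x^k only removes a multiple of a polynomial vanishing at
  \<open>z\<close>.\<close>

lemma poly_g_rem:
  assumes "z ^ k = 1"
  shows "poly (cpoly (g_rem N k)) z = poly (cpoly (g_poly N k)) z"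
proof -
  let ?X = "1 - monom 1 k :: rat poly"
  have "cpoly (g_poly N k) = cpoly (g_poly N k div ?X) * cpoly ?X + cpoly (g_rem N k)"
    by (simp only: g_rem_def cpoly_mult[symmetric] cpoly_add[symmetric] div_mult_mod_eq)
  thus ?thesis using assms by (simp add: cpoly_one_minus poly_monom)
qed

lemma degree_g_rem:
  assumes "k > 0"
  shows "degree (g_rem N k) < k"
proof -
  have deg: "degree (1 - monom 1 k :: rat poly) = k"
  proof (rule antisym)
    show "degree (1 - monom 1 k :: rat poly) \<le> k"
      by (intro degree_diff_le) (auto simp: degree_monom_eq)
    show "k \<le> degree (1 - monom 1 k :: rat poly)" using assms by (intro le_degree) simp
  qed
  hence "1 - monom 1 k \<noteq> (0 :: rat poly)" using assms by auto
  thus ?thesis using degree_mod_less[of "1 - monom 1 k" "g_poly N k"] deg assms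
    by (auto simp: g_rem_def)
qed

theorem mainTheorem1:
  fixes N k j :: nat
  assumes "N \<ge> 1" and "1 \<le> k" and "k \<le> N" and "j \<le> k - 1"
  shows "of_rat (Gamma_coeff j k N) =
    1 / (of_nat k ^ (N div k + 2) * fact (N div k)) *
      gauss_ramanujan_sum k (- int j) (k - 1 - N mod k)"
proof -
  let ?G = "cpoly (g_rem N k)" and ?s = "k - 1 - N mod k"
  let ?c = "of_nat k ^ (N div k + 1) * fact (N div k) :: complex"
  have k: "k > 0" and j: "j < k" using assms by auto
  \<comment> \<open>Positivity of the exponent ensures that the power of \<open>Theta k\<close> in
    \<open>g_poly\<close> vanishes wherever \<open>Theta k\<close> does.\<close>
  have m: "N div k \<noteq> 0" using assms by (simp add: div_eq_0_iff)
  have "of_nat k * of_rat (Gamma_coeff j k N) = of_nat k * coeff ?G j"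
    by (simp add: Gamma_coeff_def coeff_map_poly)
  also have "\<dots> = (\<Sum>z | z ^ k = 1. poly ?G z * inverse z ^ j)"
    using degree_g_rem[OF k] j by (intro coeff_eq_sum_roots_unity) (simp_all add: degree_cpoly)
  also have "\<dots> = (\<Sum>z\<in>prim_roots k. poly ?G z * inverse z ^ j)"
  proof (rule sum.mono_neutral_right)
    show "finite {z::complex. z ^ k = 1}" using k by (intro finite_roots_unity) auto
    show "\<forall>z\<in>{z. z ^ k = 1} - prim_roots k. poly ?G z * inverse z ^ j = 0"
      using m k by (auto simp: poly_g_rem g_poly_def cpoly_mult cpoly_power poly_cpoly_Theta_eq_0)
  qed (auto simp: prim_roots_def)
  also have "\<dots> = (\<Sum>z\<in>prim_roots k. q_factorial (inverse z) ?s / ?c * inverse z ^ j)"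
  proof (rule sum.cong)
    fix z assume z: "z \<in> prim_roots k"
    hence "z ^ k = 1" by (simp add: prim_roots_def)
    thus "poly ?G z * inverse z ^ j = q_factorial (inverse z) ?s / ?c * inverse z ^ j"
      by (simp only: poly_g_rem poly_g_poly_prim_root[OF assms(2,3) z])
  qed simp
  \<comment> \<open>Inversion permutes the primitive roots and turns the Fourier factor into the
    \<open>z ^ j\<close> of the Gaussian-Ramanujan sum at \<open>- int j\<close>.\<close>
  also have "\<dots> = (\<Sum>z\<in>prim_roots k. q_factorial z ?s / ?c * z ^ j)"
    by (rule sum.reindex_bij_witness[of _ inverse inverse]) (auto simp: inverse_in_prim_roots)
  also have "\<dots> = gauss_ramanujan_sum k (- int j) ?s / ?c"
    by (simp add: gauss_ramanujan_sum_def sum_divide_distrib mult_ac)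
  finally show ?thesis using k by (simp add: field_simps)
qed

end
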